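(* Let $k$ be a field, $\Sigma$ a rational pointed fan in $\mathbb{R}^d$ ($d\ge 1$), and $\mathcal{M}$ a monoidal complex supported on $\Sigma$. If $\operatorname{char}k=p>0$ and the toric face ring $k[\mathcal{M}]$ is weakly $F$-regular, then $\Sigma$ is the face poset of a cone and $k[\mathcal{M}]$ is a normal affine monoid ring.
   Context: Cones: a cone in $\mathbb{R}^d$ is a finite intersection of closed half-spaces bounded by hyperplanes through the origin. It is rational if the hyperplanes can be defined by homogeneous linear equations with integer coefficients. A face of a cone $C$ is $C$ itself or the intersection of $C$ with a supporting hyperplane through the origin; the face poset of $C$ is the set of all its faces. $C$ is pointed if $\{0\}$ is a face of $C$. All cones are rational and pointed. Monoids: an affine monoid is a finitely generated submonoid $M$ of some $\mathbb{Z}^d$; $\mathbb{Z}M$ is the subgroup it generates and $\mathbb{R}_+M$ the cone of nonnegative real combinations of its elements. $M$ is normal if every $x\in\mathbb{Z}M$ with $qx\in M$ for some integer $q>0$ lies in $M$. The affine monoid ring $k[M]$ is the monoid algebra; it is a normal affine monoid ring if it is normal. Fans and monoidal complexes: a rational pointed fan $\Sigma$ in $\mathbb{R}^d$ is a finite nonempty set of rational pointed cones such that faces of members are members, and the intersection of two members is a common face of both. A monoidal complex $\mathcal{M}$ supported on $\Sigma$ is a family of affine monoids $(M_C)_{C\in\Sigma}$ with $M_C\subseteq C\cap\mathbb{Z}^d$, $\mathbb{R}_+M_C=C$, and $M_D=M_C\cap D$ whenever $D$ is a face of $C$. Put $|\mathcal{M}|=\bigcup_{C\in\Sigma}M_C$.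 Toric face ring: $k[\mathcal{M}]=\bigoplus_{a\in|\mathcal{M}|}k\,X^a$ as a $k$-vector space, with $X^a\cdot X^b=X^{a+b}$ if $a,b\in M_C$ for some $C\in\Sigma$, and $X^aX^b=0$ otherwise. A Noetherian ring $R$ of characteristic $p>0$ is weakly $F$-regular if every ideal of $R$ is tightly closed. Here an ideal $I$ is tightly closed if it contains every $x\in R$ for which there is $c\in R$, not in any minimal prime of $R$, with $cx^{q}\in I^{[q]}$ for all sufficiently large $q=p^e$, where $I^{[q]}$ is generated by the $q$-th powers of the elements of $I$. *)

theory Defs
  imports
    "HOL-Analysis.Analysis"
    "HOL-Library.Poly_Mapping"
    "HOL-Algebra.Ring_Divisibility"
    "HOL-Algebra.QuotRing"
begin

definition integer_lattice :: "(real^'d) set" where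
  "integer_lattice = {x. \<forall>i. x $ i \<in> \<int>}"

text \<open>The empty intersection of half-spaces, i.e. the whole space, is allowed; it is not pointed.\<close>

definition rational_cone :: "(real^'d) set \<Rightarrow> bool" where
  "rational_cone C \<longleftrightarrow>
     (\<exists>A. finite A \<and> A \<subseteq> integer_lattice \<and> 0 \<notin> A \<and> C = (\<Inter>a\<in>A. {x. a \<bullet> x \<ge> 0}))"

text \<open>Replacing \<open>a\<close> by \<open>- a\<close> accounts for hyperplanes supporting \<open>C\<close> from the other side.\<close>

definition cone_face :: "(real^'d) set \<Rightarrow> (real^'d) set \<Rightarrow> bool" where
  "cone_face F C \<longleftrightarrow>
     F = C \<or> (\<exists>a. a \<noteq> 0 \<and> C \<subseteq> {x. a \<bullet> x \<ge> 0} \<and> F = C \<inter> {x. a \<bullet> x = 0})"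

definition face_poset :: "(real^'d) set \<Rightarrow> (real^'d) set set" where
  "face_poset C = {F. cone_face F C}"

definition pointed_cone :: "(real^'d) set \<Rightarrow> bool" where
  "pointed_cone C \<longleftrightarrow> cone_face {0} C"

definition rational_pointed_fan :: "(real^'d) set set \<Rightarrow> bool" where
  "rational_pointed_fan \<Sigma> \<longleftrightarrow>
     finite \<Sigma> \<and> \<Sigma> \<noteq> {} \<and>
     (\<forall>C\<in>\<Sigma>. rational_cone C \<and> pointed_cone C) \<and>
     (\<forall>C\<in>\<Sigma>. \<forall>F. cone_face F C \<longrightarrow> F \<in> \<Sigma>) \<and>
     (\<forall>C\<in>\<Sigma>. \<forall>D\<in>\<Sigma>. cone_face (C \<inter> D) C \<and> cone_face (C \<inter> D) D)"

definition is_add_submonoid :: "'a::comm_monoid_add set \<Rightarrow> bool" where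
  "is_add_submonoid M \<longleftrightarrow> 0 \<in> M \<and> (\<forall>x\<in>M. \<forall>y\<in>M. x + y \<in> M)"

definition is_add_subgroup :: "'a::ab_group_add set \<Rightarrow> bool" where
  "is_add_subgroup G \<longleftrightarrow> is_add_submonoid G \<and> (\<forall>x\<in>G. - x \<in> G)"

definition affine_monoid :: "(real^'d) set \<Rightarrow> bool" where
  "affine_monoid M \<longleftrightarrow>
     M \<subseteq> integer_lattice \<and> (\<exists>G. finite G \<and> M = is_add_submonoid hull G)"

definition group_span :: "(real^'d) set \<Rightarrow> (real^'d) set" where
  "group_span M = is_add_subgroup hull M"

definition cone_span :: "(real^'d) set \<Rightarrow> (real^'d) set" where
  "cone_span M = {(\<Sum>x\<in>F. t x *\<^sub>R x) | F t. finite F \<and> F \<subseteq> M \<and> (\<forall>x\<in>F. t x \<ge> 0)}"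

definition normal_monoid :: "(real^'d) set \<Rightarrow> bool" where
  "normal_monoid M \<longleftrightarrow>
     (\<forall>x\<in>group_span M. \<forall>q::nat. q > 0 \<and> real q *\<^sub>R x \<in> M \<longrightarrow> x \<in> M)"

definition monoidal_complex ::
    "(real^'d) set set \<Rightarrow> ((real^'d) set \<Rightarrow> (real^'d) set) \<Rightarrow> bool" where
  "monoidal_complex \<Sigma> M \<longleftrightarrow>
     (\<forall>C\<in>\<Sigma>. affine_monoid (M C) \<and> M C \<subseteq> C \<inter> integer_lattice \<and> cone_span (M C) = C) \<and>
     (\<forall>C\<in>\<Sigma>. \<forall>D. cone_face D C \<longrightarrow> M D = M C \<inter> D)"

definition complex_support ::
    "(real^'d) set set \<Rightarrow> ((real^'d) set \<Rightarrow> (real^'d) set) \<Rightarrow> (real^'d) set" where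
  "complex_support \<Sigma> M = (\<Union>C\<in>\<Sigma>. M C)"

text \<open>
  The element \<open>\<Sum>a. c a * X\<^sup>a\<close> is the finitely supported function \<open>c\<close>, so that
  \<open>X\<^sup>a\<close> is \<^term>\<open>Poly_Mapping.single a 1\<close>.
\<close>

definition toric_mult ::
    "(real^'d) set set \<Rightarrow> ((real^'d) set \<Rightarrow> (real^'d) set) \<Rightarrow>
     (real^'d \<Rightarrow>\<^sub>0 'k::field) \<Rightarrow> (real^'d \<Rightarrow>\<^sub>0 'k) \<Rightarrow> (real^'d \<Rightarrow>\<^sub>0 'k)" where
  "toric_mult \<Sigma> M f g =
     (\<Sum>a\<in>Poly_Mapping.keys f. \<Sum>b\<in>Poly_Mapping.keys g.
        if \<exists>C\<in>\<Sigma>. a \<in> M C \<and> b \<in> M C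
        then Poly_Mapping.single (a + b) (Poly_Mapping.lookup f a * Poly_Mapping.lookup g b)
        else 0)"

definition toric_face_ring ::
    "(real^'d) set set \<Rightarrow> ((real^'d) set \<Rightarrow> (real^'d) set) \<Rightarrow> (real^'d \<Rightarrow>\<^sub>0 'k::field) ring" where
  "toric_face_ring \<Sigma> M =
     \<lparr>carrier = {f. Poly_Mapping.keys f \<subseteq> complex_support \<Sigma> M},
      monoid.mult = toric_mult \<Sigma> M, one = Poly_Mapping.single 0 1, zero = 0, add = (+)\<rparr>"

definition affine_monoid_ring :: "(real^'d) set \<Rightarrow> (real^'d \<Rightarrow>\<^sub>0 'k::field) ring" where
  "affine_monoid_ring N =
     \<lparr>carrier = {f. Poly_Mapping.keys f \<subseteq> N},
      monoid.mult = (*), one = 1, zero = 0, add = (+)\<rparr>"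

text \<open>
  The operations of two records may differ outside the carriers, so equality of rings is
  expressed by the identity map being an isomorphism.  This forces \<open>N\<close> to be the set of all
  \<open>a\<close> with \<open>X\<^sup>a\<close> in the ring, and the identification is compatible with the \<open>k\<close>-algebra
  structure and the grading.
\<close>

definition is_normal_affine_monoid_ring :: "(real^'d \<Rightarrow>\<^sub>0 'k::field) ring \<Rightarrow> bool" where
  "is_normal_affine_monoid_ring R \<longleftrightarrow>
     (\<exists>N. affine_monoid N \<and> normal_monoid N \<and> (\<lambda>f. f) \<in> ring_iso R (affine_monoid_ring N))"

definition minimal_prime :: "'a set \<Rightarrow> ('a, 'b) ring_scheme \<Rightarrow> bool" where
  "minimal_prime P R \<longleftrightarrow> primeideal P R \<and> (\<forall>Q. primeideal Q R \<and> Q \<subseteq> P \<longrightarrow> Q = P)"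

definition frobenius_power :: "('a, 'b) ring_scheme \<Rightarrow> 'a set \<Rightarrow> nat \<Rightarrow> 'a set" where
  "frobenius_power R I q = genideal R ((\<lambda>x. x [^]\<^bsub>R\<^esub> q) ` I)"

definition tight_closure :: "nat \<Rightarrow> ('a, 'b) ring_scheme \<Rightarrow> 'a set \<Rightarrow> 'a set" where
  "tight_closure p R I =
     {x \<in> carrier R. \<exists>c\<in>carrier R. (\<forall>P. minimal_prime P R \<longrightarrow> c \<notin> P) \<and>
        (\<exists>e0. \<forall>e\<ge>e0. c \<otimes>\<^bsub>R\<^esub> (x [^]\<^bsub>R\<^esub> (p ^ e)) \<in> frobenius_power R I (p ^ e))}"

definition tightly_closed :: "nat \<Rightarrow> ('a, 'b) ring_scheme \<Rightarrow> 'a set \<Rightarrow> bool" where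
  "tightly_closed p R I \<longleftrightarrow> tight_closure p R I \<subseteq> I"

definition has_characteristic :: "('a, 'b) ring_scheme \<Rightarrow> nat \<Rightarrow> bool" where
  "has_characteristic R p \<longleftrightarrow> (\<forall>n::nat. [n] \<cdot>\<^bsub>R\<^esub> \<one>\<^bsub>R\<^esub> = \<zero>\<^bsub>R\<^esub> \<longleftrightarrow> p dvd n)"

definition weakly_F_regular :: "nat \<Rightarrow> ('a, 'b) ring_scheme \<Rightarrow> bool" where
  "weakly_F_regular p R \<longleftrightarrow>
     cring R \<and> noetherian_ring R \<and> p > 0 \<and> has_characteristic R p \<and>
     (\<forall>I. ideal I R \<longrightarrow> tightly_closed p R I)"

end

theory Submission
  imports Defs
begin

text \<open>
  Let \<open>R\<close> be the toric face ring.  Weak F-regularity enters through principal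
  ideals: if \<open>c\<close> lies in no minimal prime and \<open>c * x\<^sup>q\<close> is a multiple of \<open>y\<^sup>q\<close> for all
  \<open>q > 0\<close>, then \<open>x\<close> is a multiple of \<open>y\<close> (\<open>weakly_F_regular_principal\<close>).  To apply it one must know
  the minimal primes.  For a cone \<open>E\<close> of the fan, the elements without terms in \<open>M E\<close> form a prime
  \<open>P\<^sub>E\<close>, and every prime contains some \<open>P\<^sub>E\<close> with \<open>E\<close> maximal.  Hence an element that has, for each
  maximal cone \<open>E\<close>, a term with exponent in \<open>M E\<close> avoids all minimal primes
  (\<open>avoids_minimal_primes\<close>).

  Suppose that there were two maximal cones.  Choose in each maximal cone \<open>E\<close> a point
  \<open>b\<^sub>E\<close> of \<open>M E\<close> that lies in no proper face, and let \<open>c\<close> be the sum of the monomials \<open>X\<^sup>b\<close> over these points.  Products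
  of two different summands vanish, so \<open>x = X\<^sup>b\<close> satisfies \<open>x * c = x * x\<close>, thus \<open>c * x\<^sup>q = x * c\<^sup>q\<close>,
  and \<open>x = f * c\<close> for some \<open>f\<close>.  But every chosen point has in \<open>f * c\<close> the same coefficient,
  namely the constant term of \<open>f\<close>, while in \<open>x\<close> only one of them has a nonzero coefficient.  In
  other words, \<open>x / c\<close> is an idempotent of the total ring of fractions, it would have to lie in
  \<open>R\<close>, and the grading of \<open>R\<close> leaves no room for it.

  Hence the fan is the face poset of its maximal cone \<open>C\<close>, and \<open>R\<close> is the monoid ring of \<open>M C\<close>.  For
  normality, write an element of the group of \<open>M C\<close> as \<open>u - v\<close> with \<open>u, v \<in> M C\<close>, and let
  \<open>n * (u - v) \<in> M C\<close> with \<open>n > 0\<close>.  Then \<open>n * v + q * (u - v)\<close> lies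
  in \<open>M C\<close> for all \<open>q\<close>, which says that \<open>X\<^sup>n\<^sup>v * (X\<^sup>u)\<^sup>q\<close> is a multiple of \<open>(X\<^sup>v)\<^sup>q\<close>.  Therefore
  \<open>X\<^sup>u\<close> is a multiple of \<open>X\<^sup>v\<close>, that is, \<open>u - v \<in> M C\<close>.
\<close>

section \<open>Weakly F-regular rings\<close>

lemma weakly_F_regular_principal:
  fixes R (structure)
  assumes reg: "weakly_F_regular p R"
    and car: "x \<in> carrier R" "y \<in> carrier R" "c \<in> carrier R"
    and c: "\<And>P. minimal_prime P R \<Longrightarrow> c \<notin> P"
    and eq: "\<And>q::nat. q > 0 \<Longrightarrow> \<exists>r\<in>carrier R. c \<otimes> x [^] q = r \<otimes> y [^] q"
  shows "\<exists>r\<in>carrier R. x = r \<otimes> y"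
proof -
  interpret cring R using reg by (simp add: weakly_F_regular_def)
  have p: "p > 0" using reg by (simp add: weakly_F_regular_def)
  have "c \<otimes> x [^] q \<in> frobenius_power R (PIdl y) q" if q: "q > 0" for q :: nat
  proof -
    have sub: "(\<lambda>z. z [^] q) ` (PIdl y) \<subseteq> carrier R"
      using car by (auto simp: cgenideal_def)
    have I: "ideal (frobenius_power R (PIdl y) q) R"
      unfolding frobenius_power_def by (rule genideal_ideal[OF sub])
    have "y [^] q \<in> frobenius_power R (PIdl y) q"
      unfolding frobenius_power_def
      using genideal_self[OF sub] cgenideal_self[OF car(2)] by blast
    with eq[OF q] ideal.I_l_closed[OF I] show ?thesis by auto
  qed
  hence "x \<in> tight_closure p R (PIdl y)"
    unfolding tight_closure_def using car c p by (auto intro!: bexI[of _ c])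
  moreover have "tightly_closed p R (PIdl y)"
    using reg cgenideal_ideal[OF car(2)] by (simp add: weakly_F_regular_def)
  ultimately show ?thesis by (auto simp: tightly_closed_def cgenideal_def)
qed

text \<open>
  If \<open>c\<close> is a nonzerodivisor, \<open>x * c = x * x\<close> says that the fraction \<open>x / c\<close> is idempotent.  The
  equation gives
  \<open>c * x\<^sup>q = x\<^sup>q\<^sup>+\<^sup>1 = x * c\<^sup>q\<close> for all \<open>q > 0\<close>, so \<open>x\<close> is in the tight closure of the ideal of \<open>c\<close>.
\<close>

lemma weakly_F_regular_absorption:
  fixes R (structure)
  assumes reg: "weakly_F_regular p R"
    and car: "x \<in> carrier R" "c \<in> carrier R"
    and c: "\<And>P. minimal_prime P R \<Longrightarrow> c \<notin> P"
    and xc: "x \<otimes> c = x \<otimes> x"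
  shows "\<exists>r\<in>carrier R. x = r \<otimes> c"
proof (rule weakly_F_regular_principal[OF reg car(1) car(2) car(2) c])
  interpret cring R using reg by (simp add: weakly_F_regular_def)
  have pow: "x \<otimes> c [^] n = x [^] Suc n" for n :: nat
  proof (induction n)
    case (Suc n)
    have "x \<otimes> c [^] Suc n = (x \<otimes> c [^] n) \<otimes> c" using car by (simp add: m_assoc)
    also have "\<dots> = x [^] n \<otimes> (x \<otimes> c)" using Suc car by (simp add: m_assoc)
    also have "\<dots> = x [^] Suc (Suc n)" using car by (simp add: xc m_assoc)
    finally show ?case .
  qed (use car in simp)
  fix q :: nat assume "q > 0"
  then obtain n where n: "q = Suc n" using gr0_conv_Suc by blast
  have "c \<otimes> x [^] q = x [^] n \<otimes> (x \<otimes> c)" using n car by (simp add: m_ac)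
  also have "\<dots> = x [^] Suc q" using n car by (simp add: xc m_assoc)
  finally have "c \<otimes> x [^] q = x \<otimes> c [^] q" using pow[of q] by simp
  with car show "\<exists>r\<in>carrier R. c \<otimes> x [^] q = r \<otimes> c [^] q" by blast
qed

section \<open>Submonoids of the lattice\<close>

lemma is_add_submonoid_hull: "is_add_submonoid (is_add_submonoid hull G)"
  by (rule hull_in) (auto simp: is_add_submonoid_def)

lemma affine_monoid_submonoid: "affine_monoid N \<Longrightarrow> is_add_submonoid N"
  using is_add_submonoid_hull by (auto simp: affine_monoid_def)

lemma submonoid_sum:
  assumes "is_add_submonoid N" "\<And>i. i \<in> I \<Longrightarrow> f i \<in> N"
  shows "sum f I \<in> N"
  using assms by (induction I rule: infinite_finite_induct) (auto simp: is_add_submonoid_def)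

lemma submonoid_scale:
  fixes N :: "(real^'d) set"
  assumes "is_add_submonoid N" "a \<in> N"
  shows "real n *\<^sub>R a \<in> N"
  using assms by (induction n) (auto simp: is_add_submonoid_def scaleR_add_left)

lemma group_span_difference:
  assumes N: "is_add_submonoid N" and x: "x \<in> group_span N"
  obtains u v where "u \<in> N" "v \<in> N" "x = u - v"
proof -
  let ?D = "{u - v | u v. u \<in> N \<and> v \<in> N}"
  have zero: "0 \<in> N" and add: "\<And>a b. a \<in> N \<Longrightarrow> b \<in> N \<Longrightarrow> a + b \<in> N"
    using N by (auto simp: is_add_submonoid_def)
  have "is_add_subgroup ?D"
    unfolding is_add_subgroup_def is_add_submonoid_def
  proof (intro conjI ballI)
    show "0 \<in> ?D" using zero by force
    show "a + b \<in> ?D" if "a \<in> ?D" "b \<in> ?D" for a b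
    proof -
      from that obtain u v u' v' where
        h: "u \<in> N" "v \<in> N" "u' \<in> N" "v' \<in> N" "a = u - v" "b = u' - v'" by blast
      hence "a + b = (u + u') - (v + v')" by simp
      with h add show ?thesis by blast
    qed
    show "- a \<in> ?D" if "a \<in> ?D" for a
      using that by (auto, metis minus_diff_eq)
  qed
  moreover have "N \<subseteq> ?D" using zero by (force intro: diff_zero[symmetric])
  ultimately have "group_span N \<subseteq> ?D" unfolding group_span_def by (intro hull_minimal)
  with x that show thesis by blast
qed

text \<open>
  The multiples of an element \<open>u - v\<close> of the normalization can be moved into \<open>N\<close> by one shift that
  does not depend on the multiple: modulo \<open>n * (u - v)\<close> only the multipliers \<open>r < n\<close> matter, and
  for those \<open>n * v + r * (u - v) = r * u + (n - r) * v\<close>.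
\<close>

lemma multiple_plus_shift_mem:
  fixes N :: "(real^'d) set"
  assumes N: "is_add_submonoid N" and uv: "u \<in> N" "v \<in> N"
    and n: "n > 0" "real n *\<^sub>R (u - v) \<in> N"
  shows "real n *\<^sub>R v + real q *\<^sub>R (u - v) \<in> N"
proof -
  define s r where "s = q div n" and "r = q mod n"
  have q: "real q = real s * real n + real r"
    unfolding s_def r_def by (metis div_mult_mod_eq of_nat_add of_nat_mult)
  have r: "r < n" using n by (simp add: r_def)
  have "real n *\<^sub>R v + real q *\<^sub>R (u - v)
      = real s *\<^sub>R (real n *\<^sub>R (u - v)) + (real r *\<^sub>R u + real (n - r) *\<^sub>R v)"
    using r by (simp add: q algebra_simps of_nat_diff)
  also have "\<dots> \<in> N"
  proof -
    have "real s *\<^sub>R (real n *\<^sub>R (u - v)) \<in> N"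
      "real r *\<^sub>R u \<in> N" "real (n - r) *\<^sub>R v \<in> N"
      by (intro submonoid_scale[OF N] uv n)+
    thus ?thesis using N unfolding is_add_submonoid_def by blast
  qed
  finally show ?thesis .
qed

text \<open>
  A functional that fails to separate \<open>K\<close> is orthogonal to the difference of two points of \<open>K\<close>, and
  finitely many hyperplanes do not cover the space.  Such functionals serve as term orders below.
\<close>

lemma injective_functional_exists:
  fixes K :: "(real^'d) set"
  assumes "finite K"
  obtains w where "inj_on (\<lambda>x. w \<bullet> x) K"
proof -
  let ?S = "(\<lambda>(a, b). a - b) ` (K \<times> K) - {0}"
  have "negligible (\<Union>x\<in>?S. {w. x \<bullet> w = 0})"
    using assms by (intro negligible_Union) (auto intro!: negligible_hyperplane)
  hence "(\<Union>x\<in>?S. {w. x \<bullet> w = 0}) \<noteq> UNIV"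
    using non_negligible_UNIV by metis
  then obtain w where w: "\<And>x. x \<in> ?S \<Longrightarrow> x \<bullet> w \<noteq> 0" by blast
  have "inj_on (\<lambda>x. w \<bullet> x) K"
  proof (rule inj_onI, rule ccontr)
    fix a b assume h: "a \<in> K" "b \<in> K" "w \<bullet> a = w \<bullet> b" "a \<noteq> b"
    hence "a - b \<in> ?S" by auto
    from w[OF this] h(3) show False by (simp add: inner_diff_right inner_commute)
  qed
  thus thesis by (rule that)
qed

lemma maximizer_exists:
  fixes f :: "'a \<Rightarrow> real"
  assumes "finite K" "K \<noteq> {}"
  obtains a where "a \<in> K" "\<And>b. b \<in> K \<Longrightarrow> f b \<le> f a"
proof -
  have "Max (f ` K) \<in> f ` K" using assms by simp
  then obtain a where "a \<in> K" "f a = Max (f ` K)" by auto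
  with assms that show thesis by (metis Max_ge finite_imageI imageI)
qed

lemma face_summands:
  assumes "cone_face F C" "a \<in> C" "b \<in> C" "a + b \<in> F"
  shows "a \<in> F" "b \<in> F"
  using assms by (auto simp: cone_face_def inner_add_right subset_iff add_nonneg_eq_0_iff)

section \<open>Monoidal complexes\<close>

locale monoidal_fan =
  fixes \<Sigma> :: "(real^'d) set set" and M :: "(real^'d) set \<Rightarrow> (real^'d) set"
  assumes fan: "rational_pointed_fan \<Sigma>" and complex: "monoidal_complex \<Sigma> M"
begin

lemma affine: "C \<in> \<Sigma> \<Longrightarrow> affine_monoid (M C)"
  using complex by (simp add: monoidal_complex_def)

lemma submonoid: "C \<in> \<Sigma> \<Longrightarrow> is_add_submonoid (M C)"
  using affine affine_monoid_submonoid by blast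

lemma add_mem: "C \<in> \<Sigma> \<Longrightarrow> a \<in> M C \<Longrightarrow> b \<in> M C \<Longrightarrow> a + b \<in> M C"
  using submonoid by (auto simp: is_add_submonoid_def)

lemma zero_mem: "C \<in> \<Sigma> \<Longrightarrow> 0 \<in> M C"
  using submonoid by (auto simp: is_add_submonoid_def)

lemma monoid_subset_cone: "C \<in> \<Sigma> \<Longrightarrow> M C \<subseteq> C"
  using complex by (auto simp: monoidal_complex_def)

lemma inter_face: "C \<in> \<Sigma> \<Longrightarrow> D \<in> \<Sigma> \<Longrightarrow> cone_face (C \<inter> D) C"
  using fan by (simp add: rational_pointed_fan_def)

lemma monoid_inter:
  assumes "C \<in> \<Sigma>" "D \<in> \<Sigma>"
  shows "M (C \<inter> D) = M C \<inter> D"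
proof -
  have "M (C \<inter> D) = M C \<inter> (C \<inter> D)"
    using complex inter_face[OF assms] assms by (simp add: monoidal_complex_def)
  thus ?thesis using monoid_subset_cone[OF assms(1)] by blast
qed

lemma monoid_of_mem_cone:
  assumes "C \<in> \<Sigma>" "D \<in> \<Sigma>" "a \<in> M C" "a \<in> D"
  shows "a \<in> M D"
  using monoid_inter[OF assms(1,2)] monoid_inter[OF assms(2,1)] assms(3,4)
  by (metis IntD1 IntI Int_commute)

lemma monoid_mono: "C \<in> \<Sigma> \<Longrightarrow> D \<in> \<Sigma> \<Longrightarrow> C \<subseteq> D \<Longrightarrow> M C \<subseteq> M D"
  using monoid_of_mem_cone monoid_subset_cone by blast

lemma cone_subset_of_monoid_subset:
  assumes "C \<in> \<Sigma>" "D \<in> \<Sigma>" "M C \<subseteq> M D"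
  shows "C \<subseteq> D"
proof -
  have "cone_span (M C) \<subseteq> cone_span (M D)"
    using assms(3) unfolding cone_span_def by blast
  thus ?thesis using complex assms by (simp add: monoidal_complex_def)
qed

text \<open>
  A linear form that is nonnegative on \<open>C\<close> and vanishes on \<open>a + b\<close> vanishes on \<open>a\<close> and \<open>b\<close>.  This is what makes \<open>cone_prime E\<close> below a prime
  ideal: a product reaches \<open>M E\<close> only through factors with exponents in \<open>M E\<close>.
\<close>

lemma summands_mem:
  assumes "C \<in> \<Sigma>" "E \<in> \<Sigma>" "a \<in> M C" "b \<in> M C" "a + b \<in> M E"
  shows "a \<in> M E" "b \<in> M E"
proof -
  have C: "a \<in> C" "b \<in> C" "a + b \<in> C \<inter> E"
    using assms monoid_subset_cone add_mem by blast+
  note face = face_summands[OF inter_face[OF assms(1,2)] C]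
  show "a \<in> M E"
    by (rule monoid_of_mem_cone[OF assms(1,2,3)]) (use face in blast)
  show "b \<in> M E"
    by (rule monoid_of_mem_cone[OF assms(1,2,4)]) (use face in blast)
qed

lemma sum_summands_mem:
  assumes "C \<in> \<Sigma>" "E \<in> \<Sigma>" "finite G" "G \<subseteq> M C" "\<Sum>G \<in> M E"
  shows "G \<subseteq> M E"
  using assms(3-)
proof (induction G rule: finite_induct)
  case (insert g G)
  have G: "\<Sum>G \<in> M C"
    using insert.prems by (intro submonoid_sum[OF submonoid[OF assms(1)]]) auto
  with insert.hyps insert.prems summands_mem[OF assms(1,2), of g "\<Sum>G"]
  show ?case using insert.IH by auto
qed simp

text \<open>
  The sum of a finite generating set of \<open>M C\<close> plays the role of a relative interior point: a member
  of the fan whose monoid contains the sum contains all generators, hence \<open>C\<close>.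
\<close>

lemma interior_point_exists:
  assumes "C \<in> \<Sigma>"
  obtains b where "b \<in> M C" "\<And>E. E \<in> \<Sigma> \<Longrightarrow> b \<in> M E \<Longrightarrow> C \<subseteq> E"
proof -
  obtain G where G: "finite G" "M C = is_add_submonoid hull G"
    using affine[OF assms] by (auto simp: affine_monoid_def)
  hence sub: "G \<subseteq> M C" by (simp add: hull_subset)
  have b: "\<Sum>G \<in> M C"
    using sub by (intro submonoid_sum[OF submonoid[OF assms]]) auto
  moreover have "C \<subseteq> E" if "E \<in> \<Sigma>" "\<Sum>G \<in> M E" for E
  proof -
    have "G \<subseteq> M E" by (rule sum_summands_mem[OF assms that(1) G(1) sub that(2)])
    hence "M C \<subseteq> M E" using G(2) submonoid[OF that(1)] by (simp add: hull_minimal)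
    thus ?thesis using cone_subset_of_monoid_subset assms that by blast
  qed
  ultimately show thesis by (rule that)
qed

definition maximal_cones :: "(real^'d) set set" where
  "maximal_cones = {C \<in> \<Sigma>. \<forall>D\<in>\<Sigma>. C \<subseteq> D \<longrightarrow> D = C}"

lemma in_maximal_cone:
  assumes "C \<in> \<Sigma>"
  shows "\<exists>D\<in>maximal_cones. C \<subseteq> D"
proof -
  have "finite \<Sigma>" using fan by (simp add: rational_pointed_fan_def)
  from finite_has_maximal2[OF this assms]
  obtain D where "D \<in> \<Sigma>" "C \<subseteq> D" "\<And>E. E \<in> \<Sigma> \<Longrightarrow> D \<subseteq> E \<Longrightarrow> D = E" by auto
  thus ?thesis by (intro bexI[of _ D]) (auto simp: maximal_cones_def)
qed

lemma face_poset_of_unique_maximal_cone: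
  assumes "maximal_cones = {C}"
  shows "\<Sigma> = face_poset C"
proof -
  have C: "C \<in> \<Sigma>" using assms by (auto simp: maximal_cones_def)
  have "D \<in> face_poset C" if "D \<in> \<Sigma>" for D
  proof -
    have "D \<subseteq> C" using in_maximal_cone[OF that] assms by blast
    hence "C \<inter> D = D" by blast
    with inter_face[OF C that] show ?thesis by (simp add: face_poset_def)
  qed
  moreover have "face_poset C \<subseteq> \<Sigma>"
    using fan C by (auto simp: face_poset_def rational_pointed_fan_def)
  ultimately show ?thesis by blast
qed

section \<open>The toric face ring\<close>

abbreviation R :: "(real^'d \<Rightarrow>\<^sub>0 'k::field) ring" where
  "R \<equiv> toric_face_ring \<Sigma> M"

abbreviation monomial :: "real^'d \<Rightarrow> (real^'d \<Rightarrow>\<^sub>0 'k::field)" where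
  "monomial a \<equiv> Poly_Mapping.single a 1"

abbreviation compatible :: "real^'d \<Rightarrow> real^'d \<Rightarrow> bool" where
  "compatible a b \<equiv> \<exists>C\<in>\<Sigma>. a \<in> M C \<and> b \<in> M C"

lemma toric_face_ring_sel [simp]:
  "carrier R = {f. Poly_Mapping.keys f \<subseteq> complex_support \<Sigma> M}"
  "f \<otimes>\<^bsub>R\<^esub> g = toric_mult \<Sigma> M f g"
  "\<one>\<^bsub>R\<^esub> = monomial 0" "\<zero>\<^bsub>R\<^esub> = 0" "f \<oplus>\<^bsub>R\<^esub> g = f + g"
  by (simp_all add: toric_face_ring_def)

lemma sum_of_terms:
  fixes h :: "'a \<Rightarrow>\<^sub>0 'b::comm_monoid_add"
  shows "h = (\<Sum>a\<in>Poly_Mapping.keys h. Poly_Mapping.single a (Poly_Mapping.lookup h a))"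
  by (rule poly_mapping_eqI) (auto simp: lookup_sum lookup_single when_def in_keys_iff)

lemma lookup_toric_mult:
  "Poly_Mapping.lookup (toric_mult \<Sigma> M f g) c =
     (\<Sum>(a, b)\<in>{(a, b). a \<in> Poly_Mapping.keys f \<and> b \<in> Poly_Mapping.keys g \<and>
        compatible a b \<and> a + b = c}. Poly_Mapping.lookup f a * Poly_Mapping.lookup g b)"
proof -
  have "Poly_Mapping.lookup (toric_mult \<Sigma> M f g) c =
     (\<Sum>(a, b)\<in>Poly_Mapping.keys f \<times> Poly_Mapping.keys g. if compatible a b \<and> a + b = c
        then Poly_Mapping.lookup f a * Poly_Mapping.lookup g b else 0)"
    unfolding toric_mult_def sum.cartesian_product[symmetric] lookup_sum
    by (intro sum.cong refl) (auto simp: lookup_single when_def)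
  also have "\<dots> = (\<Sum>(a, b)\<in>{(a, b). a \<in> Poly_Mapping.keys f \<and> b \<in> Poly_Mapping.keys g \<and>
        compatible a b \<and> a + b = c}. Poly_Mapping.lookup f a * Poly_Mapping.lookup g b)"
    by (rule sum.mono_neutral_cong_right) (auto split: if_splits)
  finally show ?thesis .
qed

lemma keys_toric_mult:
  assumes "c \<in> Poly_Mapping.keys (toric_mult \<Sigma> M f g)"
  obtains a b C where "a \<in> Poly_Mapping.keys f" "b \<in> Poly_Mapping.keys g"
    "C \<in> \<Sigma>" "a \<in> M C" "b \<in> M C" "a + b = c"
proof -
  have "Poly_Mapping.lookup (toric_mult \<Sigma> M f g) c \<noteq> 0"
    using assms by (simp add: in_keys_iff)
  then obtain a b where "a \<in> Poly_Mapping.keys f" "b \<in> Poly_Mapping.keys g"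
    "compatible a b" "a + b = c"
    unfolding lookup_toric_mult by (auto elim!: sum.not_neutral_contains_not_neutral)
  with that show thesis by blast
qed

lemma toric_mult_single:
  "toric_mult \<Sigma> M (Poly_Mapping.single a s) (Poly_Mapping.single b t) =
     (if compatible a b then Poly_Mapping.single (a + b) (s * t) else 0)"
proof (cases "s = 0 \<or> t = 0")
  case True
  then show ?thesis by (auto simp: toric_mult_def)
next
  case False
  then have "Poly_Mapping.keys (Poly_Mapping.single a s) = {a}"
    "Poly_Mapping.keys (Poly_Mapping.single b t) = {b}" by simp_all
  then show ?thesis
    unfolding toric_mult_def by (simp only: sum.insert finite.emptyI empty_iff not_False_eq_True
      sum.empty add_0_right lookup_single_eq)
qed

lemma toric_mult_monomial:
  "toric_mult \<Sigma> M (monomial a) (monomial b) = (if compatible a b then monomial (a + b) else 0)"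
  by (simp only: toric_mult_single mult_1_left)

lemma monomial_carrier: "C \<in> \<Sigma> \<Longrightarrow> a \<in> M C \<Longrightarrow> monomial a \<in> carrier R"
  by (auto simp: complex_support_def)

lemma monomial_pow:
  assumes "C \<in> \<Sigma>" "a \<in> M C"
  shows "monomial a [^]\<^bsub>R\<^esub> (n::nat) = monomial (real n *\<^sub>R a)"
proof (induction n)
  case (Suc n)
  have "compatible (real n *\<^sub>R a) a"
    using assms submonoid_scale[OF submonoid] by blast
  with Suc show ?case by (simp add: toric_mult_monomial scaleR_add_left add.commute)
qed simp

lemma toric_mult_eq_times:
  assumes "C \<in> \<Sigma>" "Poly_Mapping.keys f \<subseteq> M C" "Poly_Mapping.keys g \<subseteq> M C"
  shows "toric_mult \<Sigma> M f g = f * g"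
proof -
  have "toric_mult \<Sigma> M f g = (\<Sum>a\<in>Poly_Mapping.keys f. \<Sum>b\<in>Poly_Mapping.keys g.
      Poly_Mapping.single (a + b) (Poly_Mapping.lookup f a * Poly_Mapping.lookup g b))"
    unfolding toric_mult_def using assms by (intro sum.cong refl) auto
  also have "\<dots> = f * g"
    by (subst (3) sum_of_terms, subst (4) sum_of_terms) (simp add: sum_product mult_single)
  finally show ?thesis .
qed

section \<open>Minimal primes\<close>

text \<open>The kernel of the projection of the toric face ring onto the monoid ring of \<open>M E\<close>.\<close>

definition cone_prime :: "(real^'d) set \<Rightarrow> (real^'d \<Rightarrow>\<^sub>0 'k::field) set" where
  "cone_prime E = {f \<in> carrier R. Poly_Mapping.keys f \<inter> M E = {}}"

lemma cone_prime_closed: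
  assumes "E \<in> \<Sigma>" "Poly_Mapping.keys f \<inter> M E = {} \<or> Poly_Mapping.keys g \<inter> M E = {}"
  shows "Poly_Mapping.keys (toric_mult \<Sigma> M f g) \<inter> M E = {}"
proof -
  have False if c: "c \<in> Poly_Mapping.keys (toric_mult \<Sigma> M f g)" "c \<in> M E" for c
    using c(1)
  proof (rule keys_toric_mult)
    fix a b C assume h: "a \<in> Poly_Mapping.keys f" "b \<in> Poly_Mapping.keys g"
      "C \<in> \<Sigma>" "a \<in> M C" "b \<in> M C" "a + b = c"
    with summands_mem[OF h(3) assms(1) h(4,5)] c(2) assms(2) show False by blast
  qed
  thus ?thesis by blast
qed

text \<open>
  The argument with leading terms, applied to the terms in \<open>M E\<close>: with respect to a functional that
  separates the exponents of \<open>f\<close> and \<open>g\<close>, the product of the two leading terms cannot cancel.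
\<close>

lemma product_meets_cone:
  assumes E: "E \<in> \<Sigma>"
    and f: "Poly_Mapping.keys f \<inter> M E \<noteq> {}" and g: "Poly_Mapping.keys g \<inter> M E \<noteq> {}"
  shows "Poly_Mapping.keys (toric_mult \<Sigma> M f g) \<inter> M E \<noteq> {}"
proof -
  obtain w where w: "inj_on (\<lambda>x. w \<bullet> x) (Poly_Mapping.keys f \<union> Poly_Mapping.keys g)"
    by (rule injective_functional_exists[of "Poly_Mapping.keys f \<union> Poly_Mapping.keys g"]) auto
  obtain a where a: "a \<in> Poly_Mapping.keys f \<inter> M E"
    and a_max: "\<And>a'. a' \<in> Poly_Mapping.keys f \<inter> M E \<Longrightarrow> w \<bullet> a' \<le> w \<bullet> a"
    using maximizer_exists[OF _ f, of "\<lambda>x. w \<bullet> x"] by auto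
  obtain b where b: "b \<in> Poly_Mapping.keys g \<inter> M E"
    and b_max: "\<And>b'. b' \<in> Poly_Mapping.keys g \<inter> M E \<Longrightarrow> w \<bullet> b' \<le> w \<bullet> b"
    using maximizer_exists[OF _ g, of "\<lambda>x. w \<bullet> x"] by auto
  have ab: "a + b \<in> M E" using a b add_mem[OF E] by blast
  have "{(a', b'). a' \<in> Poly_Mapping.keys f \<and> b' \<in> Poly_Mapping.keys g \<and>
      compatible a' b' \<and> a' + b' = a + b} = {(a, b)}" (is "?L = _")
  proof (intro equalityI subsetI)
    fix z assume "z \<in> ?L"
    then obtain a' b' C where z: "z = (a', b')"
      and h: "a' \<in> Poly_Mapping.keys f" "b' \<in> Poly_Mapping.keys g"
        "C \<in> \<Sigma>" "a' \<in> M C" "b' \<in> M C" and s: "a' + b' = a + b" by blast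
    have "a' \<in> M E" "b' \<in> M E"
      using summands_mem[OF h(3) E h(4,5)] s ab by auto
    with h a_max b_max have "w \<bullet> a' \<le> w \<bullet> a" "w \<bullet> b' \<le> w \<bullet> b" by auto
    moreover have "w \<bullet> a' + w \<bullet> b' = w \<bullet> a + w \<bullet> b"
      using s by (metis inner_add_right)
    ultimately have "w \<bullet> a' = w \<bullet> a" by linarith
    hence "a' = a" using inj_onD[OF w] h(1) a by auto
    with s z show "z \<in> {(a, b)}" by simp
  qed (use a b E in auto)
  hence "Poly_Mapping.lookup (toric_mult \<Sigma> M f g) (a + b)
      = Poly_Mapping.lookup f a * Poly_Mapping.lookup g b"
    by (simp add: lookup_toric_mult)
  also have "\<dots> \<noteq> 0" using a b by (auto simp: in_keys_iff)
  finally show ?thesis using ab by (auto simp: in_keys_iff)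
qed

lemma cone_prime_prime:
  assumes R: "cring (R :: (real^'d \<Rightarrow>\<^sub>0 'k::field) ring)" and E: "E \<in> \<Sigma>"
  shows "primeideal (cone_prime E) (R :: (real^'d \<Rightarrow>\<^sub>0 'k) ring)"
proof -
  interpret cring "R :: (real^'d \<Rightarrow>\<^sub>0 'k) ring" by (rule R)
  let ?P = "cone_prime E :: (real^'d \<Rightarrow>\<^sub>0 'k) set"
  have inv: "\<ominus>\<^bsub>R\<^esub> f = - f" if "f \<in> carrier R" for f :: "real^'d \<Rightarrow>\<^sub>0 'k"
    using that by (intro minus_equality) auto
  have add: "additive_subgroup ?P R"
  proof (intro additive_subgroupI subgroup.intro)
    show "?P \<subseteq> carrier (add_monoid R)" by (auto simp: cone_prime_def)
    show "f \<otimes>\<^bsub>add_monoid R\<^esub> g \<in> ?P" if "f \<in> ?P" "g \<in> ?P" for f g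
      using that keys_add[of f g] unfolding cone_prime_def by (simp, blast)
    show "\<one>\<^bsub>add_monoid R\<^esub> \<in> ?P" by (simp add: cone_prime_def)
    show "inv\<^bsub>add_monoid R\<^esub> f \<in> ?P" if "f \<in> ?P" for f
      using that inv[of f] by (auto simp: cone_prime_def a_inv_def)
  qed
  have one: "monomial 0 \<in> carrier R" "monomial 0 \<notin> ?P"
    using E zero_mem[OF E] by (auto simp: cone_prime_def complex_support_def)
  show ?thesis
  proof (rule primeidealI2[OF add R])
    show "g \<otimes>\<^bsub>R\<^esub> f \<in> ?P" if "f \<in> ?P" "g \<in> carrier R" for f g
      using that m_closed[of g f] cone_prime_closed[OF E, of g f] by (auto simp: cone_prime_def)
    show "f \<otimes>\<^bsub>R\<^esub> g \<in> ?P" if "f \<in> ?P" "g \<in> carrier R" for f g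
      using that m_closed[of f g] cone_prime_closed[OF E, of f g] by (auto simp: cone_prime_def)
    show "carrier R \<noteq> ?P" using one by blast
    show "f \<in> ?P \<or> g \<in> ?P" if "f \<in> carrier R" "g \<in> carrier R" "f \<otimes>\<^bsub>R\<^esub> g \<in> ?P" for f g
      using that product_meets_cone[OF E, of f g] by (auto simp: cone_prime_def)
  qed
qed

text \<open>
  Let \<open>A\<close> be the set of exponents of the monomials outside \<open>P\<close>.  Because \<open>P\<close> is prime and contains
  \<open>0\<close>, any two elements of \<open>A\<close> share a cone and \<open>A\<close> is closed under addition.  If for each cone \<open>E\<close>
  some element of \<open>A\<close> were outside \<open>M E\<close>, the sum of these elements would be outside every \<open>M E\<close>.
  So \<open>A\<close> lies in a single \<open>M E\<close>, and \<open>P\<close> contains all monomials of the ring with exponents outside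
  \<open>M E\<close>.
\<close>

lemma prime_contains_cone_prime:
  assumes P: "primeideal P (R :: (real^'d \<Rightarrow>\<^sub>0 'k::field) ring)"
  obtains E where "E \<in> maximal_cones" "cone_prime E \<subseteq> P"
proof -
  interpret P: primeideal P "R :: (real^'d \<Rightarrow>\<^sub>0 'k) ring" by (rule P)
  let ?X = "monomial :: real^'d \<Rightarrow> (real^'d \<Rightarrow>\<^sub>0 'k)"
  define A where "A = {a \<in> complex_support \<Sigma> M. ?X a \<notin> P}"
  have sub: "additive_subgroup P (R :: (real^'d \<Rightarrow>\<^sub>0 'k) ring)"
    by (rule ideal.axioms(1)[OF P.is_ideal])
  have zero: "0 \<in> P" using additive_subgroup.zero_closed[OF sub] by simp
  have A_add: "compatible a b \<and> a + b \<in> A" if "a \<in> A" "b \<in> A" for a b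
  proof -
    have car: "?X a \<in> carrier R" "?X b \<in> carrier R"
      using that by (auto simp: A_def)
    have notin: "toric_mult \<Sigma> M (?X a) (?X b) \<notin> P"
      using P.I_prime[OF car] that by (auto simp: A_def)
    hence "compatible a b" "?X (a + b) \<notin> P"
      using zero by (auto simp: toric_mult_monomial split: if_splits)
    thus ?thesis using add_mem by (auto simp: A_def complex_support_def)
  qed
  have "\<exists>E\<in>\<Sigma>. A \<subseteq> M E"
  proof (rule ccontr)
    assume neg: "\<not> (\<exists>E\<in>\<Sigma>. A \<subseteq> M E)"
    have "finite \<Sigma>" "\<Sigma> \<noteq> {}" using fan by (auto simp: rational_pointed_fan_def)
    \<comment> \<open>Adding a witness for one more cone keeps the old ones, since a sum in a face has its summands there.\<close>
    have "S \<subseteq> \<Sigma> \<Longrightarrow> \<exists>b\<in>A. \<forall>E\<in>S. b \<notin> M E" if "finite S" for S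
      using that
    proof (induction S)
      case empty
      from \<open>\<Sigma> \<noteq> {}\<close> neg show ?case by blast
    next
      case (insert E S)
      then obtain b where b: "b \<in> A" "\<forall>F\<in>S. b \<notin> M F" by blast
      obtain a where a: "a \<in> A" "a \<notin> M E" using insert.prems neg by blast
      obtain C where C: "C \<in> \<Sigma>" "a \<in> M C" "b \<in> M C" "a + b \<in> A"
        using A_add[OF a(1) b(1)] by blast
      have "a + b \<notin> M F" if "F \<in> insert E S" for F
        using summands_mem[OF C(1) _ C(2,3), of F] that a b insert.prems by blast
      with C(4) show ?case by blast
    qed
    from this[OF \<open>finite \<Sigma>\<close>] show False by (auto simp: A_def complex_support_def)
  qed
  then obtain E' where E': "E' \<in> \<Sigma>" "A \<subseteq> M E'" by blast
  obtain E where E: "E \<in> maximal_cones" "E' \<subseteq> E" using in_maximal_cone[OF E'(1)] by blast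
  hence AE: "A \<subseteq> M E" "E \<in> \<Sigma>"
    using E' monoid_mono[of E' E] by (auto simp: maximal_cones_def)
  have "f \<in> P" if f: "f \<in> cone_prime E" for f
  proof -
    have term_mem: "Poly_Mapping.single a t \<in> P" if a: "a \<in> Poly_Mapping.keys f" for a t
    proof -
      have sup: "a \<in> complex_support \<Sigma> M" and "a \<notin> M E"
        using f a by (auto simp: cone_prime_def)
      hence XP: "?X a \<in> P" using AE(1) by (auto simp: A_def)
      obtain C where C: "C \<in> \<Sigma>" "a \<in> M C" using sup by (auto simp: complex_support_def)
      have "Poly_Mapping.single 0 t \<in> carrier R"
        using zero_mem[OF C(1)] C(1) by (auto simp: complex_support_def)
      from P.I_l_closed[OF XP this]
      have "toric_mult \<Sigma> M (Poly_Mapping.single 0 t) (?X a) \<in> P" by simp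
      moreover have "toric_mult \<Sigma> M (Poly_Mapping.single 0 t) (?X a) = Poly_Mapping.single a t"
        using C zero_mem[OF C(1)] by (auto simp: toric_mult_single)
      ultimately show ?thesis by simp
    qed
    have "(\<Sum>a\<in>S. Poly_Mapping.single a (Poly_Mapping.lookup f a)) \<in> P"
      if "finite S" "S \<subseteq> Poly_Mapping.keys f" for S
      using that
    proof (induction S)
      case (insert a S)
      thus ?case
        using additive_subgroup.a_closed[OF sub, of
            "Poly_Mapping.single a (Poly_Mapping.lookup f a)"
            "\<Sum>a\<in>S. Poly_Mapping.single a (Poly_Mapping.lookup f a)"] term_mem by simp
    qed (use zero in simp)
    from this[of "Poly_Mapping.keys f"]
    have "(\<Sum>a\<in>Poly_Mapping.keys f. Poly_Mapping.single a (Poly_Mapping.lookup f a)) \<in> P" by simp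
    moreover have "f = (\<Sum>a\<in>Poly_Mapping.keys f. Poly_Mapping.single a (Poly_Mapping.lookup f a))"
      by (rule sum_of_terms)
    ultimately show ?thesis by simp
  qed
  with E(1) that show thesis by blast
qed

lemma avoids_minimal_primes:
  assumes R: "cring (R :: (real^'d \<Rightarrow>\<^sub>0 'k::field) ring)"
    and c: "\<And>E. E \<in> maximal_cones \<Longrightarrow> Poly_Mapping.keys c \<inter> M E \<noteq> {}"
    and P: "minimal_prime P (R :: (real^'d \<Rightarrow>\<^sub>0 'k) ring)"
  shows "c \<notin> P"
proof -
  from P have "primeideal P R" by (simp add: minimal_prime_def)
  then obtain E where E: "E \<in> maximal_cones" "cone_prime E \<subseteq> P"
    by (rule prime_contains_cone_prime)
  hence "P = cone_prime E"
    using P cone_prime_prime[OF R, of E] by (auto simp: minimal_prime_def maximal_cones_def)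
  thus ?thesis using c[OF E(1)] by (auto simp: cone_prime_def)
qed

section \<open>Consequences of weak F-regularity\<close>

text \<open>
  Two maximal cones would produce a nontrivial idempotent in the total ring of fractions.  The set \<open>B\<close>
  in the proof consists of one interior point of each maximal cone; two of them never share a cone,
  because a cone that contains such a point contains the maximal cone around it.
\<close>

lemma unique_maximal_cone:
  assumes reg: "weakly_F_regular p (R :: (real^'d \<Rightarrow>\<^sub>0 'k::field) ring)"
  obtains C where "maximal_cones = {C}"
proof -
  interpret cring "R :: (real^'d \<Rightarrow>\<^sub>0 'k) ring"
    using reg by (simp add: weakly_F_regular_def)
  have fin: "finite maximal_cones"
    using fan by (auto simp: maximal_cones_def rational_pointed_fan_def)
  have "\<forall>C\<in>\<Sigma>. \<exists>b. b \<in> M C \<and> (\<forall>E\<in>\<Sigma>. b \<in> M E \<longrightarrow> C \<subseteq> E)"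
    using interior_point_exists by metis
  then obtain \<beta> where \<beta>: "\<And>C. C \<in> \<Sigma> \<Longrightarrow> \<beta> C \<in> M C"
    "\<And>C E. C \<in> \<Sigma> \<Longrightarrow> E \<in> \<Sigma> \<Longrightarrow> \<beta> C \<in> M E \<Longrightarrow> C \<subseteq> E" by metis
  define B where "B = \<beta> ` maximal_cones"
  have finB: "finite B" using fin by (simp add: B_def)
  have only: "E = C" if "C \<in> maximal_cones" "E \<in> \<Sigma>" "\<beta> C \<in> M E" for C E
    using that \<beta>(2)[of C E] by (auto simp: maximal_cones_def)
  have separated: "a = b" if "a \<in> B" "b \<in> B" "compatible a b" for a b
    using that only unfolding B_def by blast
  define c :: "real^'d \<Rightarrow>\<^sub>0 'k" where "c = (\<Sum>b\<in>B. monomial b)"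
  have look: "Poly_Mapping.lookup c e = (if e \<in> B then 1 else 0)" for e
    using finB by (simp add: c_def lookup_sum lookup_single when_def)
  have keys: "Poly_Mapping.keys c = B" by (auto simp: in_keys_iff look split: if_splits)
  have B_sup: "B \<subseteq> complex_support \<Sigma> M"
    using \<beta>(1) by (auto simp: B_def complex_support_def maximal_cones_def)
  have car: "c \<in> carrier R" using B_sup keys by simp
  have avoid: "c \<notin> P" if "minimal_prime P R" for P
    by (rule avoids_minimal_primes[OF is_cring _ that])
      (use \<beta>(1) in \<open>auto simp: keys B_def maximal_cones_def\<close>)
  \<comment> \<open>If \<open>a = e + b\<close> with \<open>e\<close> and \<open>b\<close> in one cone, then \<open>a\<close> and \<open>b\<close> share that cone, so \<open>b = a\<close> and \<open>e = 0\<close>.\<close>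
  have const: "Poly_Mapping.lookup (toric_mult \<Sigma> M f c) a = Poly_Mapping.lookup f 0"
    if a: "a \<in> B" for a and f :: "real^'d \<Rightarrow>\<^sub>0 'k"
  proof -
    obtain C where C: "C \<in> \<Sigma>" "a \<in> M C" using a B_sup by (auto simp: complex_support_def)
    have "{(e, b). e \<in> Poly_Mapping.keys f \<and> b \<in> Poly_Mapping.keys c \<and>
        compatible e b \<and> e + b = a} = (if 0 \<in> Poly_Mapping.keys f then {(0, a)} else {})"
      (is "?L = ?S")
    proof (intro equalityI subsetI)
      fix z assume "z \<in> ?L"
      then obtain e b E where z: "z = (e, b)" "e \<in> Poly_Mapping.keys f" "b \<in> B"
        "E \<in> \<Sigma>" "e \<in> M E" "b \<in> M E" "e + b = a" by (auto simp: keys)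
      have "a \<in> M E" using add_mem z by blast
      hence "a = b" using separated a z by blast
      with z show "z \<in> ?S" by auto
    next
      fix z assume "z \<in> ?S"
      thus "z \<in> ?L" using a C zero_mem[OF C(1)] by (auto simp: keys split: if_splits)
    qed
    thus ?thesis using a by (auto simp: lookup_toric_mult look in_keys_iff)
  qed
  have single: "B = {a}" if a: "a \<in> B" for a
  proof (rule ccontr)
    assume "B \<noteq> {a}"
    then obtain b where b: "b \<in> B" "b \<noteq> a" using a by blast
    let ?x = "monomial a :: real^'d \<Rightarrow>\<^sub>0 'k"
    have xcar: "?x \<in> carrier R" using a B_sup by auto
    have "toric_mult \<Sigma> M ?x c = (\<Sum>b\<in>B. if compatible a b then monomial (a + b) else 0)"
    proof -
      have "Poly_Mapping.keys ?x = {a}" by simp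
      then show ?thesis
        unfolding toric_mult_def keys by (simp only:) (auto intro!: sum.cong simp: look)
    qed
    also have "\<dots> = (\<Sum>b\<in>B. if b = a then (if compatible a b then monomial (a + b) else 0) else 0)"
      using separated[OF a] by (intro sum.cong) auto
    also have "\<dots> = toric_mult \<Sigma> M ?x ?x"
      using finB a by (simp add: toric_mult_monomial sum.delta)
    finally have "?x \<otimes>\<^bsub>R\<^esub> c = ?x \<otimes>\<^bsub>R\<^esub> ?x" by simp
    from weakly_F_regular_absorption[OF reg xcar car avoid this]
    obtain f where "?x = toric_mult \<Sigma> M f c" by auto
    hence "Poly_Mapping.lookup ?x a = Poly_Mapping.lookup ?x b"
      using const[OF a] const[OF b(1)] by simp
    thus False using b(2) by (simp add: lookup_single)
  qed
  obtain C where C: "C \<in> maximal_cones"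
  proof -
    obtain C0 where "C0 \<in> \<Sigma>" using fan by (auto simp: rational_pointed_fan_def)
    thus thesis using in_maximal_cone that by blast
  qed
  have "D = C" if D: "D \<in> maximal_cones" for D
  proof -
    have "\<beta> D = \<beta> C" using single[of "\<beta> C"] C D by (auto simp: B_def)
    thus ?thesis using only[OF C, of D] \<beta>(1)[of D] D by (auto simp: maximal_cones_def)
  qed
  with C have "maximal_cones = {C}" by blast
  thus thesis by (rule that)
qed

text \<open>
  The tight closure test is applied to \<open>X\<^sup>u\<close> and the ideal of \<open>X\<^sup>v\<close>, with the multiplier \<open>X\<^sup>n\<^sup>v\<close> that
  \<open>multiple_plus_shift_mem\<close> provides.
\<close>

lemma normal_of_unique_maximal_cone:
  assumes reg: "weakly_F_regular p (R :: (real^'d \<Rightarrow>\<^sub>0 'k::field) ring)"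
    and max: "maximal_cones = {C}"
  shows "normal_monoid (M C)"
  unfolding normal_monoid_def
proof (intro ballI allI impI)
  fix x and n :: nat
  assume x: "x \<in> group_span (M C)" and n: "n > 0 \<and> real n *\<^sub>R x \<in> M C"
  have C: "C \<in> \<Sigma>" using max by (auto simp: maximal_cones_def)
  note N = submonoid[OF C]
  obtain u v where uv: "u \<in> M C" "v \<in> M C" "x = u - v"
    using group_span_difference[OF N x] .
  interpret cring "R :: (real^'d \<Rightarrow>\<^sub>0 'k) ring"
    using reg by (simp add: weakly_F_regular_def)
  let ?X = "monomial :: real^'d \<Rightarrow> (real^'d \<Rightarrow>\<^sub>0 'k)"
  let ?c = "?X (real n *\<^sub>R v)"
  have nv: "real n *\<^sub>R v \<in> M C" using submonoid_scale[OF N uv(2)] .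
  have avoid: "?c \<notin> P" if "minimal_prime P R" for P
    by (rule avoids_minimal_primes[OF is_cring _ that]) (use nv max in auto)
  have "\<exists>r\<in>carrier R. ?X u = r \<otimes>\<^bsub>R\<^esub> ?X v"
  proof (rule weakly_F_regular_principal[OF reg _ _ _ avoid])
    fix q :: nat
    \<comment> \<open>the exponent of the cofactor: \<open>n * v + q * u = m + q * v\<close>\<close>
    define m where "m = real n *\<^sub>R v + real q *\<^sub>R (u - v)"
    have m: "m \<in> M C"
      unfolding m_def using multiple_plus_shift_mem[OF N uv(1,2)] n uv(3) by blast
    have qm: "real q *\<^sub>R u \<in> M C" "real q *\<^sub>R v \<in> M C"
      using submonoid_scale[OF N] uv by auto
    have "real n *\<^sub>R v + real q *\<^sub>R u = m + real q *\<^sub>R v"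
      by (simp add: m_def algebra_simps)
    hence "?c \<otimes>\<^bsub>R\<^esub> ?X u [^]\<^bsub>R\<^esub> q = ?X m \<otimes>\<^bsub>R\<^esub> ?X v [^]\<^bsub>R\<^esub> q"
      unfolding monomial_pow[OF C uv(1)] monomial_pow[OF C uv(2)] toric_face_ring_sel toric_mult_monomial
      using C m qm nv by auto
    thus "\<exists>r\<in>carrier R. ?c \<otimes>\<^bsub>R\<^esub> ?X u [^]\<^bsub>R\<^esub> q = r \<otimes>\<^bsub>R\<^esub> ?X v [^]\<^bsub>R\<^esub> q"
      using monomial_carrier[OF C m] by blast
  qed (use monomial_carrier[OF C] uv nv in auto)
  then obtain f where f: "f \<in> carrier R" "?X u = toric_mult \<Sigma> M f (?X v)" by auto
  have "u \<in> Poly_Mapping.keys (?X u)" by simp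
  hence "u \<in> Poly_Mapping.keys (toric_mult \<Sigma> M f (?X v))" unfolding f(2) .
  then obtain a b E where ab: "b \<in> Poly_Mapping.keys (?X v)" "E \<in> \<Sigma>" "a \<in> M E" "a + b = u"
    by (rule keys_toric_mult)
  have "E \<subseteq> C" using in_maximal_cone[OF ab(2)] max by blast
  hence "a \<in> M C" using monoid_mono[OF ab(2) C] ab(3) by blast
  moreover have "x = a" using ab uv by auto
  ultimately show "x \<in> M C" by simp
qed

lemma affine_monoid_ring_of_unique_maximal_cone:
  assumes max: "maximal_cones = {C}"
  shows "(\<lambda>f. f) \<in> ring_iso (R :: (real^'d \<Rightarrow>\<^sub>0 'k::field) ring) (affine_monoid_ring (M C))"
proof -
  have C: "C \<in> \<Sigma>" using max by (auto simp: maximal_cones_def)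
  have "M D \<subseteq> M C" if D: "D \<in> \<Sigma>" for D
    using in_maximal_cone[OF D] max monoid_mono[OF D C] by blast
  hence "complex_support \<Sigma> M = M C"
    using C by (auto simp: complex_support_def)
  thus ?thesis
    by (intro ring_iso_memI)
      (auto simp: affine_monoid_ring_def toric_mult_eq_times[OF C] bij_betw_def)
qed

end

theorem proposition6p8:
  fixes \<Sigma> :: "(real^'d) set set"
    and M :: "(real^'d) set \<Rightarrow> (real^'d) set"
    and p :: nat
  assumes "rational_pointed_fan \<Sigma>"
    and "monoidal_complex \<Sigma> M"
    and "CHAR('k::field) = p" and "p > 0"
    and "weakly_F_regular p (toric_face_ring \<Sigma> M :: (real^'d \<Rightarrow>\<^sub>0 'k) ring)"
  shows "(\<exists>C. rational_cone C \<and> pointed_cone C \<and> \<Sigma> = face_poset C) \<and>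
         is_normal_affine_monoid_ring (toric_face_ring \<Sigma> M :: (real^'d \<Rightarrow>\<^sub>0 'k) ring)"
proof -
  interpret monoidal_fan \<Sigma> M by unfold_locales (fact assms)+
  obtain C where max: "maximal_cones = {C}" using unique_maximal_cone[OF assms(5)] .
  hence C: "C \<in> \<Sigma>" by (auto simp: maximal_cones_def)
  hence "rational_cone C \<and> pointed_cone C"
    using assms(1) by (simp add: rational_pointed_fan_def)
  moreover note face_poset_of_unique_maximal_cone[OF max]
  moreover have "is_normal_affine_monoid_ring (toric_face_ring \<Sigma> M :: (real^'d \<Rightarrow>\<^sub>0 'k) ring)"
    unfolding is_normal_affine_monoid_ring_def
    using affine[OF C] normal_of_unique_maximal_cone[OF assms(5) max]
      affine_monoid_ring_of_unique_maximal_cone[OF max] by blast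
  ultimately show ?thesis by blast
qed

end
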